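(* Consider the problem $\min_{x\in\mathbb{R}^d}F(x)$, $F(x)=f(x)+\phi(x)=\frac1m\sum_{j=1}^m\sum_{i=1}^n f_{j,i}(x)+\phi(x)$, under the problem assumptions (P) and the network assumptions (N) given in the context, and let $x_{j,t}$ be the iterates of the algorithm DPG-RR given in the context, started from arbitrary $x_{j,0}\in\mathbb{R}^d$ ($j\in[m]$), with constant step-size $\gamma=M/\sqrt{T}$, where $T\ge 1$ is the total number of iterations and $0<M\le \frac{\sqrt6}{6Ln}$. Then: (1) The local estimates achieve consensus: with $\bar x_t=\frac1m\sum_{j=1}^m x_{j,t}$, for every $j\in[m]$, $\lim_{t\to\infty}\|x_{j,t}-\bar x_t\|=0$ (here the iteration, with its fixed step-size $\gamma$, is continued for all $t\in\mathbb{N}$). (2) With $\hat x_T=\frac{1}{mT}\sum_{t=1}^T\sum_{j=1}^m x_{j,t}$, one has $\mathbb{E}[F(\hat x_T)-F_*]=\mathcal{O}\big(\frac1T+\frac1{\sqrt T}\big)$; that is, there is a constant $C$ independent of $T$ (depending only on the problem and network data, the initial points and $M$) such that for every $T\ge1$, running the algorithm with $\gamma=M/\sqrt T$ gives $\mathbb{E}[F(\hat x_T)-F_*]\le C\big(\frac1T+\frac1{\sqrt T}\big)$. The expectation is over the random permutations.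
   Context: Notation: $[m]=\{1,\dots,m\}$; $\|\cdot\|$ is the Euclidean norm; $m$ is the number of agents and $n$ the number of local samples per agent. Problem assumptions (P). $f_{j,i}:\mathbb{R}^d\to\mathbb{R}$ ($j\in[m]$, $i\in[n]$) are differentiable, $f=\frac1m\sum_{j=1}^m\sum_{i=1}^n f_{j,i}$, $\phi:\mathbb{R}^d\to\mathbb{R}$ is non-smooth (not assumed differentiable), and: (a) $f$ and $\phi$ are convex; (b) there is $L>0$ with $\|\nabla f_{j,i}(x)-\nabla f_{j,i}(y)\|\le L\|x-y\|$ for all $x,y\in\mathbb{R}^d$ and all $j,i$; (c) there is a scalar $G_\phi$ with $\|z\|<G_\phi$ for every $x\in\mathbb{R}^d$ and every $z\in\partial\phi(x)$; (d) there is a scalar $G_f$ with $\|\nabla f_{j,i}(x)\|<G_f$ for all $x\in\mathbb{R}^d$ and all $j,i$; (e) $F$ is bounded below and has at least one minimizer $x_*$; $F_*=F(x_* )$ is the optimal value. Network assumptions (N). $\mathcal{G}(s)=([m],\mathcal{E}(s),A(s))$, $s=0,1,2,\dots$, is a sequence of undirected graphs with $m\times m$ adjacency (weight) matrices $A(s)=[a_{ij}(s)]$ such that: (a) each $A(s)$ is doubly stochastic; (b) there is $\eta\in(0,1)$ with $a_{jj}(s)\ge\eta$ for all $j\in[m]$, and for $i\neq j$, $a_{ij}(s)\ge\eta$ if $\{i,j\}\in\mathcal{E}(s)$ and $a_{ij}(s)=0$ otherwise; (c) the sequence is uniformly connected: there is an integer $B\ge1$ such that every agent sends its information to all other agents at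 least once in every $B$ consecutive time slots (for all $i\ne j$ and all $s$, $\{i,j\}\in\mathcal{E}(s')$ for some $s'\in\{s,\dots,s+B-1\}$). Proximal operator: $\mathrm{prox}_{\alpha,h}(x)=\mathrm{argmin}_{z\in\mathbb{R}^d}\, h(z)+\frac{1}{2\alpha}\|z-x\|^2$. Algorithm DPG-RR with step-size $\gamma>0$ and initial points $x_{j,0}\in\mathbb{R}^d$. For $t=0,1,2,\dots$: draw a uniformly random permutation $\pi_t=(\pi_t^0,\dots,\pi_t^{n-1})$ of $\{1,\dots,n\}$ (freshly and independently for each $t$; the same $\pi_t$ is used in the updates of all agents $j$); set $x_{j,t}^0=x_{j,t}$; for $i=0,\dots,n-1$ set $x_{j,t}^{i+1}=x_{j,t}^i-\gamma\nabla f_{j,\pi_t^i}(x_{j,t}^i)$; then set $v_{j,t}=\sum_{l=1}^m\lambda_{jl,t}x_{l,t}^n$ and $x_{j,t+1}=\mathrm{prox}_{\gamma,\phi}(v_{j,t})$. Here $\lambda_{jl,t}$ is the $(j,l)$ entry of $\Phi(\mathbb{T}(t)+t,\mathbb{T}(t))$, where $\Phi(r,s)=A(r)A(r-1)\cdots A(s)$ for $r\ge s\ge0$, and $\mathbb{T}(t)=\sum_{s=0}^{t-1}s=t(t-1)/2$ is the total number of communication steps before iteration $t$. *)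

theory Defs
  imports "HOL-Probability.Probability"
begin

text \<open>
  Agents are the elements of a finite type \<open>'m\<close>, so \<open>m = CARD('m)\<close>; samples are numbered
  \<open>1, \<dots>, n\<close>; \<open>f j i\<close> is the \<open>i\<close>-th local function of agent \<open>j\<close>.
\<close>

definition gradient :: "('a::euclidean_space \<Rightarrow> real) \<Rightarrow> 'a \<Rightarrow> 'a" where
  "gradient g x = (THE D. GDERIV g x :> D)"

definition subdifferential :: "('a::euclidean_space \<Rightarrow> real) \<Rightarrow> 'a \<Rightarrow> 'a set" where
  "subdifferential h x = {z. \<forall>y. h x + z \<bullet> (y - x) \<le> h y}"

definition prox :: "real \<Rightarrow> ('a::euclidean_space \<Rightarrow> real) \<Rightarrow> 'a \<Rightarrow> 'a" where
  "prox \<alpha> h x = arg_min (\<lambda>z. h z + 1 / (2 * \<alpha>) * (norm (z - x))\<^sup>2) (\<lambda>_. True)"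


subsection \<open>Problem\<close>

definition smooth_part :: "('m::finite \<Rightarrow> nat \<Rightarrow> 'a::euclidean_space \<Rightarrow> real) \<Rightarrow> nat \<Rightarrow> 'a \<Rightarrow> real" where
  "smooth_part f n x = 1 / real CARD('m) * (\<Sum>j\<in>UNIV. \<Sum>i=1..n. f j i x)"

definition objective ::
  "('m::finite \<Rightarrow> nat \<Rightarrow> 'a::euclidean_space \<Rightarrow> real) \<Rightarrow> nat \<Rightarrow> ('a \<Rightarrow> real) \<Rightarrow> 'a \<Rightarrow> real" where
  "objective f n \<phi> x = smooth_part f n x + \<phi> x"

definition problem_assms ::
  "('m::finite \<Rightarrow> nat \<Rightarrow> 'a::euclidean_space \<Rightarrow> real) \<Rightarrow> nat \<Rightarrow> ('a \<Rightarrow> real) \<Rightarrow> real \<Rightarrow> bool" where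
  "problem_assms f n \<phi> L \<longleftrightarrow>
     (\<forall>j. \<forall>i\<in>{1..n}. \<forall>x. f j i differentiable (at x)) \<and>
     convex_on UNIV (smooth_part f n) \<and> convex_on UNIV \<phi> \<and>
     0 < L \<and>
     (\<forall>j. \<forall>i\<in>{1..n}. \<forall>x y. norm (gradient (f j i) x - gradient (f j i) y) \<le> L * norm (x - y)) \<and>
     (\<exists>G\<^sub>\<phi>. \<forall>x. \<forall>z\<in>subdifferential \<phi> x. norm z < G\<^sub>\<phi>) \<and>
     (\<exists>G\<^sub>f. \<forall>j. \<forall>i\<in>{1..n}. \<forall>x. norm (gradient (f j i) x) < G\<^sub>f) \<and>
     bdd_below (range (objective f n \<phi>)) \<and>
     (\<exists>x. is_arg_min (objective f n \<phi>) (\<lambda>_. True) x)"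


subsection \<open>Network\<close>

definition doubly_stochastic :: "real^'m^'m \<Rightarrow> bool" where
  "doubly_stochastic A \<longleftrightarrow>
     (\<forall>i j. 0 \<le> A $ i $ j) \<and> (\<forall>i. (\<Sum>j\<in>UNIV. A $ i $ j) = 1) \<and> (\<forall>j. (\<Sum>i\<in>UNIV. A $ i $ j) = 1)"

text \<open>
  An edge of the undirected graph at time \<open>s\<close> is an unordered pair \<open>{i, j} \<in> E s\<close>; loops are not
  excluded, and the weights are not required to be symmetric.
\<close>

definition network_assms :: "(nat \<Rightarrow> 'm::finite set set) \<Rightarrow> (nat \<Rightarrow> real^'m^'m) \<Rightarrow> bool" where
  "network_assms E A \<longleftrightarrow>
     (\<forall>s. E s \<subseteq> {{i, j} |i j. True}) \<and>
     (\<forall>s. doubly_stochastic (A s)) \<and>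
     (\<exists>\<eta>. 0 < \<eta> \<and> \<eta> < 1 \<and>
        (\<forall>s. (\<forall>j. \<eta> \<le> A s $ j $ j) \<and>
             (\<forall>i j. i \<noteq> j \<longrightarrow> (if {i, j} \<in> E s then \<eta> \<le> A s $ i $ j else A s $ i $ j = 0)))) \<and>
     (\<exists>B\<ge>1. \<forall>i j s. i \<noteq> j \<longrightarrow> (\<exists>s'\<in>{s..<s + B}. {i, j} \<in> E s'))"


subsection \<open>Algorithm\<close>

text \<open>\<open>\<Phi>(r, s) = A(r) A(r-1) \<cdots> A(s)\<close>, for \<open>r \<ge> s\<close>.\<close>

definition transition :: "(nat \<Rightarrow> real^'m^'m) \<Rightarrow> nat \<Rightarrow> nat \<Rightarrow> real^'m^'m" where
  "transition A r s = foldr (**) (map A (rev [s..<Suc r])) (mat 1)"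

definition comm_steps :: "nat \<Rightarrow> nat" where
  "comm_steps t = (\<Sum>s<t. s)"

text \<open>
  \<open>local_pass \<gamma> g p i x\<close> is the local iterate after \<open>i\<close> gradient steps from \<open>x\<close>, for the local functions
  \<open>g 1, \<dots>, g n\<close> visited in the order given by the list \<open>p\<close>, a permutation of \<open>1, \<dots>, n\<close>.
\<close>

primrec local_pass ::
  "real \<Rightarrow> (nat \<Rightarrow> 'a::euclidean_space \<Rightarrow> real) \<Rightarrow> nat list \<Rightarrow> nat \<Rightarrow> 'a \<Rightarrow> 'a" where
  "local_pass \<gamma> g p 0 x = x"
| "local_pass \<gamma> g p (Suc i) x =
     local_pass \<gamma> g p i x - \<gamma> *\<^sub>R gradient (g (p ! i)) (local_pass \<gamma> g p i x)"

text \<open>\<open>dpg_rr \<gamma> f n \<phi> A x0 p t j\<close> is the iterate \<open>x\<^sub>j\<^sub>,\<^sub>t\<close> when the permutations drawn are \<open>p 0, p 1, \<dots>\<close>.\<close>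

primrec dpg_rr ::
  "real \<Rightarrow> ('m::finite \<Rightarrow> nat \<Rightarrow> 'a::euclidean_space \<Rightarrow> real) \<Rightarrow> nat \<Rightarrow> ('a \<Rightarrow> real) \<Rightarrow>
   (nat \<Rightarrow> real^'m^'m) \<Rightarrow> ('m \<Rightarrow> 'a) \<Rightarrow> (nat \<Rightarrow> nat list) \<Rightarrow> nat \<Rightarrow> 'm \<Rightarrow> 'a" where
  "dpg_rr \<gamma> f n \<phi> A x0 p 0 = x0"
| "dpg_rr \<gamma> f n \<phi> A x0 p (Suc t) = (\<lambda>j. prox \<gamma> \<phi>
     (\<Sum>l\<in>UNIV. transition A (comm_steps t + t) (comm_steps t) $ j $ l *\<^sub>R
        local_pass \<gamma> (f l) (p t) n (dpg_rr \<gamma> f n \<phi> A x0 p t l)))"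

definition agent_mean :: "('m::finite \<Rightarrow> 'a::euclidean_space) \<Rightarrow> 'a" where
  "agent_mean x = (1 / real CARD('m)) *\<^sub>R (\<Sum>j\<in>UNIV. x j)"

definition ergodic_mean :: "(nat \<Rightarrow> 'm::finite \<Rightarrow> 'a::euclidean_space) \<Rightarrow> nat \<Rightarrow> 'a" where
  "ergodic_mean x T = (1 / (real CARD('m) * real T)) *\<^sub>R (\<Sum>t=1..T. \<Sum>j\<in>UNIV. x t j)"

text \<open>
  Each \<open>\<pi> t\<close> maps every point of the sample space to a permutation: measurability into the
  \<open>count_space\<close> of the set of permutations is part of \<open>indep_vars\<close>.
\<close>

definition iid_uniform_permutations :: "'w measure \<Rightarrow> nat \<Rightarrow> (nat \<Rightarrow> 'w \<Rightarrow> nat list) \<Rightarrow> bool" where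
  "iid_uniform_permutations \<Omega> n \<pi> \<longleftrightarrow>
     prob_space.indep_vars \<Omega> (\<lambda>_. count_space (permutations_of_set {1..n})) \<pi> UNIV \<and>
     (\<forall>t. distr \<Omega> (count_space (permutations_of_set {1..n})) (\<pi> t) =
          uniform_count_measure (permutations_of_set {1..n}))"

end

theory Submission
  imports Defs
begin

text \<open>
  The bound is proved for every realised sequence of permutations, with a constant that depends
  neither on the sequence nor on \<open>T\<close>, and is then integrated. This is possible because all gradients
  are bounded: during one pass an agent moves by \<open>O(\<gamma>)\<close>, so by Lipschitz continuity its total
  direction differs from its full local gradient by \<open>O(\<gamma>)\<close>, whatever the order of the samples
  (\<open>pass_direction_error\<close>).

  Consensus. A product of \<open>B\<close> consecutive weight matrices has all entries at least \<open>\<eta> ^ B\<close> and thus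
  contracts the diameter of the agent values by a fixed factor (\<open>network_mixing_rate\<close>). Local passes
  increase the diameter by \<open>O(\<gamma>)\<close> and proximal steps do not increase it (\<open>prox_nonexpansive\<close>). As the
  number of communication steps grows with \<open>t\<close>, the diameter is bounded by a summable sequence
  of the form \<open>c * \<rho> ^ t * (R + t * b)\<close>, the same for all step sizes up to \<open>M\<close> (\<open>consensus_rate\<close>).

  Rate. Mixing preserves the average of the agents, so the average performs a perturbed subgradient
  step: the gradients at the old average and the subgradients of \<open>\<phi>\<close> at the new iterates, which the
  optimality condition \<open>prox_subgradient\<close> provides. Hence the squared distance \<open>S t\<close> of the average to
  the minimizer satisfies \<open>S (t + 1) + 2 * \<gamma> * H t \<le> (1 + e t) * S t + e t\<close>, where \<open>H t\<close> is the mean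
  suboptimality of the agents at time \<open>t + 1\<close> and \<open>e t\<close> consists of terms of order \<open>\<gamma>\<^sup>2\<close> and of \<open>\<gamma>\<close>
  times diameters (\<open>descent\<close>). With \<open>\<gamma> = M / sqrt T\<close> the sum of \<open>e t\<close> over \<open>t < T\<close> is bounded
  independently of \<open>T\<close>, and a Gronwall argument (\<open>sum_le_exp_sum\<close>) bounds \<open>\<gamma> * (\<Sum>t<T. H t)\<close> by a
  constant. Dividing by \<open>\<gamma> * T = M * sqrt T\<close> and using convexity of the objective gives the claim
  (\<open>ergodic_gap\<close>).
\<close>

section \<open>Averages over the agents\<close>

lemma norm_diff_agent_mean:
  fixes x :: "'m::finite \<Rightarrow> 'a::euclidean_space"
  assumes "\<And>j. norm (y - x j) \<le> d"
  shows "norm (y - agent_mean x) \<le> d"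
proof -
  let ?m = "real CARD('m)"
  have "y - agent_mean x = (1 / ?m) *\<^sub>R (\<Sum>j\<in>UNIV. y - x j)"
    by (simp add: agent_mean_def sum_subtractf scaleR_diff_right scaleR_conv_of_real[symmetric]
        sum_constant_scaleR del: sum_constant)
  also have "norm \<dots> \<le> (1 / ?m) * (\<Sum>j\<in>(UNIV::'m set). d)"
    unfolding norm_scaleR by (intro mult_mono sum_norm_le) (auto intro: assms)
  also have "\<dots> = d" by simp
  finally show ?thesis .
qed

lemma agent_mean_add: "agent_mean (\<lambda>j. x j + y j) = agent_mean x + agent_mean y"
  by (simp add: agent_mean_def sum.distrib scaleR_add_right)

lemma agent_mean_diff: "agent_mean (\<lambda>j. x j - y j) = agent_mean x - agent_mean y"
  by (simp add: agent_mean_def sum_subtractf scaleR_diff_right)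

lemma agent_mean_scaleR: "agent_mean (\<lambda>j. c *\<^sub>R x j) = c *\<^sub>R agent_mean x"
  by (simp add: agent_mean_def scaleR_sum_right[symmetric] mult.commute)

lemma agent_mean_const: "agent_mean (\<lambda>_::'m::finite. c) = c"
  by (simp add: agent_mean_def sum_constant_scaleR del: sum_constant)

lemma agent_mean_inner: "agent_mean x \<bullet> y = agent_mean (\<lambda>j. x j \<bullet> y)"
  by (simp add: agent_mean_def inner_sum_left)

lemma agent_mean_mono:
  fixes x y :: "'m::finite \<Rightarrow> real"
  shows "(\<And>j. x j \<le> y j) \<Longrightarrow> agent_mean x \<le> agent_mean y"
  by (simp add: agent_mean_def sum_mono divide_right_mono)

lemma norm_agent_mean_le:
  fixes x :: "'m::finite \<Rightarrow> 'a::euclidean_space"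
  shows "(\<And>j. norm (x j) \<le> d) \<Longrightarrow> norm (agent_mean x) \<le> d"
  using norm_diff_agent_mean[of 0 x d] by simp

lemma convex_agent_mean:
  fixes x :: "'m::finite \<Rightarrow> 'a::euclidean_space"
  assumes "convex_on UNIV F"
  shows "F (agent_mean x) \<le> agent_mean (\<lambda>j. F (x j))"
  using convex_on_sum[OF _ _ assms, of "UNIV :: 'm set" "\<lambda>_. 1 / real CARD('m)" x]
  by (simp add: agent_mean_def scaleR_sum_right sum_distrib_left sum_divide_distrib)

section \<open>Mixing by doubly stochastic weights\<close>

definition mix :: "real^'m^'m \<Rightarrow> ('m::finite \<Rightarrow> 'a::euclidean_space) \<Rightarrow> 'm \<Rightarrow> 'a" where
  "mix P x = (\<lambda>j. \<Sum>l\<in>UNIV. P $ j $ l *\<^sub>R x l)"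

text \<open>
  Disagreement is measured by the diameter of the family of agent values, because this is the
  quantity that averaging contracts, and that agentwise nonexpansive maps do not increase.
\<close>

definition spread_le :: "('m::finite \<Rightarrow> 'a::euclidean_space) \<Rightarrow> real \<Rightarrow> bool" where
  "spread_le x d \<longleftrightarrow> (\<forall>j k. norm (x j - x k) \<le> d)"

lemma spread_leD: "spread_le x d \<Longrightarrow> norm (x j - x k) \<le> d"
  by (simp add: spread_le_def)

lemma spread_le_nonneg: "spread_le x d \<Longrightarrow> 0 \<le> d"
  using spread_leD[of x d undefined undefined] by simp

lemma mix_mat1: "mix (mat 1) x = x"
proof
  fix j
  have "mix (mat 1) x j = (\<Sum>l\<in>UNIV. if j = l then x l else 0)"
    unfolding mix_def by (intro sum.cong) (auto simp: mat_def)
  then show "mix (mat 1) x j = x j" by simp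
qed

lemma mix_mult: "mix (P ** Q) x = mix P (mix Q x)"
proof
  fix j
  have "mix (P ** Q) x j = (\<Sum>l\<in>UNIV. \<Sum>k\<in>UNIV. (P $ j $ k * Q $ k $ l) *\<^sub>R x l)"
    by (simp add: mix_def matrix_matrix_mult_def scaleR_sum_left)
  also have "\<dots> = (\<Sum>k\<in>UNIV. \<Sum>l\<in>UNIV. (P $ j $ k * Q $ k $ l) *\<^sub>R x l)"
    by (rule sum.swap)
  also have "\<dots> = mix P (mix Q x) j"
    by (simp add: mix_def scaleR_sum_right)
  finally show "mix (P ** Q) x j = mix P (mix Q x) j" .
qed

lemma agent_mean_mix:
  assumes "doubly_stochastic P"
  shows "agent_mean (mix P x) = agent_mean x"
proof -
  have "(\<Sum>j\<in>UNIV. mix P x j) = (\<Sum>l\<in>UNIV. \<Sum>j\<in>UNIV. P $ j $ l *\<^sub>R x l)"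
    unfolding mix_def by (rule sum.swap)
  also have "\<dots> = (\<Sum>l\<in>UNIV. x l)"
    using assms by (simp add: scaleR_sum_left[symmetric] doubly_stochastic_def)
  finally show ?thesis by (simp add: agent_mean_def)
qed

text \<open>
  Doeblin's argument: a stochastic matrix whose entries are all at least \<open>\<epsilon>\<close> contracts the diameter
  by the factor \<open>1 - \<epsilon>\<close>. Only one column is used, so no factor \<open>CARD('m)\<close> appears.
\<close>

lemma mix_contraction:
  fixes P :: "real^'m::finite^'m" and x :: "'m \<Rightarrow> 'a::euclidean_space"
  assumes P: "doubly_stochastic P" and lo: "\<And>i j. \<epsilon> \<le> P $ i $ j"
    and \<epsilon>: "0 \<le> \<epsilon>" "\<epsilon> < 1" and x: "spread_le x d"
  shows "spread_le (mix P x) ((1 - \<epsilon>) * d)"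
  unfolding spread_le_def
proof (intro allI)
  fix j k
  \<comment> \<open>
    All entries of column \<open>l0\<close> are at least \<open>\<epsilon>\<close>. Every row therefore puts the mass \<open>\<epsilon>\<close> on the
    same point \<open>x l0\<close>, and this common part cancels in the difference of two rows; what remains
    has nonnegative weights \<open>R\<close> of total mass \<open>\<kappa> = 1 - \<epsilon>\<close>.
  \<close>
  define l0 :: 'm where "l0 = undefined"
  define \<kappa> where "\<kappa> = 1 - \<epsilon>"
  define R where "R i l = P $ i $ l - (if l = l0 then \<epsilon> else 0)" for i l
  have \<kappa>: "\<kappa> > 0" using \<epsilon> by (simp add: \<kappa>_def)
  have R0: "R i l \<ge> 0" for i l
    using lo[of i l] P by (auto simp: R_def doubly_stochastic_def)
  have R1: "(\<Sum>l\<in>UNIV. R i l) = \<kappa>" for i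
    using P by (simp add: R_def \<kappa>_def sum_subtractf doubly_stochastic_def)
  have mixR: "mix P x i = (\<Sum>l\<in>UNIV. R i l *\<^sub>R x l) + \<epsilon> *\<^sub>R x l0" for i
  proof -
    have "(\<Sum>l\<in>UNIV. R i l *\<^sub>R x l) = mix P x i - (\<Sum>l\<in>UNIV. if l = l0 then \<epsilon> *\<^sub>R x l else 0)"
      unfolding mix_def sum_subtractf[symmetric]
      by (intro sum.cong) (auto simp: R_def scaleR_diff_left)
    then show ?thesis by simp
  qed
  have inner: "norm ((\<Sum>l\<in>UNIV. R j l *\<^sub>R x l) - \<kappa> *\<^sub>R x k') \<le> \<kappa> * d" for k'
  proof -
    have "(\<Sum>l\<in>UNIV. R j l *\<^sub>R x l) - \<kappa> *\<^sub>R x k' = (\<Sum>l\<in>UNIV. R j l *\<^sub>R (x l - x k'))"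
      by (simp add: scaleR_diff_right sum_subtractf scaleR_sum_left[symmetric] R1)
    also have "norm \<dots> \<le> (\<Sum>l\<in>UNIV. R j l * d)"
      by (intro sum_norm_le) (auto simp: R0 intro!: mult_left_mono spread_leD[OF x])
    finally show ?thesis by (simp add: sum_distrib_right[symmetric] R1)
  qed
  define y where "y = (\<Sum>l\<in>UNIV. R j l *\<^sub>R x l)"
  have "\<kappa> *\<^sub>R (mix P x j - mix P x k) = (\<Sum>k'\<in>UNIV. R k k' *\<^sub>R (y - \<kappa> *\<^sub>R x k'))"
    unfolding mixR[of k] mixR[of j] y_def[symmetric]
    by (simp add: scaleR_diff_right sum_subtractf scaleR_sum_left[symmetric] R1
        scaleR_sum_right mult.commute)
  also have "norm \<dots> \<le> (\<Sum>k'\<in>UNIV. R k k' * (\<kappa> * d))"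
    by (intro sum_norm_le) (auto simp: R0 y_def intro!: mult_left_mono inner)
  also have "\<dots> = \<kappa> * (\<kappa> * d)"
    by (simp add: sum_distrib_right[symmetric] R1)
  finally show "norm (mix P x j - mix P x k) \<le> (1 - \<epsilon>) * d"
    using \<kappa> by (simp add: \<kappa>_def)
qed

lemma mix_nonexpansive:
  assumes "doubly_stochastic P" "spread_le x d"
  shows "spread_le (mix P x) d"
  using mix_contraction[of P 0 x d] assms by (simp add: doubly_stochastic_def)

text \<open>
  The product \<open>A (s + k - 1) ** \<dots> ** A s\<close>. Indexing by the number of factors, with the empty product
  allowed, makes induction and splitting into blocks simpler than with \<open>transition\<close>.
\<close>

primrec window :: "(nat \<Rightarrow> real^'m^'m) \<Rightarrow> nat \<Rightarrow> nat \<Rightarrow> real^'m^'m" where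
  "window A s 0 = mat 1"
| "window A s (Suc k) = A (s + k) ** window A s k"

lemma transition_eq_window: "transition A (s + t) s = window A s (Suc t)"
proof -
  have "foldr (**) (map A (rev [s..<s + k])) (mat 1) = window A s k" for k
    by (induction k) auto
  from this[of "Suc t"] show ?thesis by (simp add: transition_def del: upt_Suc)
qed

lemma window_add: "window A s (k + l) = window A (s + k) l ** window A s k"
  by (induction l) (auto simp: matrix_mul_assoc add.assoc)

lemma doubly_stochastic_mult:
  assumes "doubly_stochastic P" "doubly_stochastic Q"
  shows "doubly_stochastic (P ** Q)"
proof -
  have "(\<Sum>j\<in>UNIV. \<Sum>k\<in>UNIV. P $ i $ k * Q $ k $ j) = 1" for i
    by (subst sum.swap) (use assms in \<open>simp add: sum_distrib_left[symmetric] doubly_stochastic_def\<close>)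
  moreover have "(\<Sum>i\<in>UNIV. \<Sum>k\<in>UNIV. P $ i $ k * Q $ k $ j) = 1" for j
    by (subst sum.swap) (use assms in \<open>simp add: sum_distrib_right[symmetric] doubly_stochastic_def\<close>)
  ultimately show ?thesis
    using assms by (auto simp: doubly_stochastic_def matrix_matrix_mult_def intro!: sum_nonneg)
qed

lemma doubly_stochastic_window:
  assumes "\<And>s. doubly_stochastic (A s)"
  shows "doubly_stochastic (window A s k)"
proof (induction k)
  case 0
  show ?case by (simp add: doubly_stochastic_def mat_def)
next
  case (Suc k)
  then show ?case using assms by (simp add: doubly_stochastic_mult)
qed

text \<open>
  One summand of the expanded product suffices: the value of agent \<open>j\<close> waits on the diagonal until
  the edge to \<open>i\<close> appears, crosses it, and waits on the diagonal again. Each of the \<open>k\<close> factors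
  contributes at least \<open>\<eta>\<close>.
\<close>

lemma window_lower_bound:
  assumes ds: "\<And>s. doubly_stochastic (A s)" and \<eta>: "0 < \<eta>"
    and diag: "\<And>s j. \<eta> \<le> A s $ j $ j"
    and edge: "\<And>s i j. i \<noteq> j \<Longrightarrow> {i, j} \<in> E s \<Longrightarrow> \<eta> \<le> A s $ i $ j"
    and ij: "i = j \<or> (\<exists>s'\<in>{s..<s + k}. {i, j} \<in> E s')"
  shows "\<eta> ^ k \<le> window A s k $ i $ j"
  using ij
proof (induction k arbitrary: i j)
  case 0
  then show ?case by (auto simp: mat_def)
next
  case (Suc k)
  have A0: "0 \<le> A (s + k) $ a $ b" and S0: "0 \<le> window A s k $ a $ b" for a b
    using ds[of "s + k"] doubly_stochastic_window[OF ds, where s = s and k = k] by (auto simp: doubly_stochastic_def)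
  have one: "A (s + k) $ i $ l * window A s k $ l $ j \<le> window A s (Suc k) $ i $ j" for l
    unfolding window.simps matrix_matrix_mult_def
    by (simp, rule member_le_sum) (auto simp: A0 S0)
  have pow: "\<eta> ^ Suc k \<le> A (s + k) $ i $ l * window A s k $ l $ j"
    if "\<eta> \<le> A (s + k) $ i $ l" "\<eta> ^ k \<le> window A s k $ l $ j" for l
    using that \<eta> by (simp add: mult_mono)
  show ?case
  proof (cases "i = j \<or> (\<exists>s'\<in>{s..<s + k}. {i, j} \<in> E s')")
    case True
    from pow[OF diag Suc.IH[OF True]] one show ?thesis by (meson order_trans)
  next
    case False
    with Suc.prems have "i \<noteq> j" "{i, j} \<in> E (s + k)"
      by (auto simp: less_Suc_eq)
    from pow[OF edge[OF this] Suc.IH[of j j]] one show ?thesis by (meson order_trans)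
  qed
qed

text \<open>
  Over \<open>B\<close> consecutive steps every pair of agents communicates, so the block product has all entries
  at least \<open>\<epsilon> = \<eta> ^ B\<close> and contracts by \<open>1 - \<epsilon>\<close>; the incomplete last block is nonexpansive. Taking
  \<open>\<rho> = 1 - \<epsilon> / B\<close>, Bernoulli's inequality bounds the factor per block by \<open>\<rho> ^ B\<close>, and \<open>c = 1 / \<rho> ^ B\<close>
  pays for the incomplete block.
\<close>

lemma network_mixing_rate:
  fixes A :: "nat \<Rightarrow> real^'m^'m"
  assumes net: "network_assms E A"
  obtains c \<rho> where "1 \<le> c" "0 < \<rho>" "\<rho> < 1"
    "\<And>s k d (x :: 'm \<Rightarrow> 'a::euclidean_space).
        spread_le x d \<Longrightarrow> spread_le (mix (window A s k) x) (c * \<rho> ^ k * d)"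
proof -
  have ds: "doubly_stochastic (A s)" for s
    using net by (simp add: network_assms_def)
  obtain \<eta> where \<eta>: "0 < \<eta>" "\<eta> < 1" and diag: "\<eta> \<le> A s $ j $ j"
    and edge: "i \<noteq> j \<Longrightarrow> {i, j} \<in> E s \<Longrightarrow> \<eta> \<le> A s $ i $ j" for s i j
    using net unfolding network_assms_def by metis
  obtain B where B: "B \<ge> 1" and conn: "i \<noteq> j \<Longrightarrow> \<exists>s'\<in>{s..<s + B}. {i, j} \<in> E s'" for i j s
    using net unfolding network_assms_def by metis
  define \<epsilon> where "\<epsilon> = \<eta> ^ B"
  define \<rho> where "\<rho> = 1 - \<epsilon> / B"
  have \<epsilon>: "0 < \<epsilon>" "\<epsilon> < 1"
    using \<eta> B by (auto simp: \<epsilon>_def power_less_one_iff)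
  have \<epsilon>B: "\<epsilon> / B < 1" "0 < \<epsilon> / B" using \<epsilon> B by (auto simp: divide_less_eq)
  have \<rho>: "0 < \<rho>" "\<rho> < 1" using \<epsilon>B by (auto simp: \<rho>_def)
  have bern: "1 - \<epsilon> \<le> \<rho> ^ B"
    using Bernoulli_inequality[of "- (\<epsilon> / B)" B] \<epsilon>B B by (simp add: \<rho>_def)
  have block: "spread_le (mix (window A s B) x) (\<rho> ^ B * d)"
    if "spread_le x d" for s d and x :: "'m \<Rightarrow> 'a"
  proof -
    have "\<epsilon> \<le> window A s B $ i $ j" for i j
    proof -
      have "i = j \<or> (\<exists>s'\<in>{s..<s + B}. {i, j} \<in> E s')" using conn by blast
      then show ?thesis
        unfolding \<epsilon>_def using ds \<eta>(1) diag edge by (intro window_lower_bound[where E = E])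
    qed
    then have "spread_le (mix (window A s B) x) ((1 - \<epsilon>) * d)"
      using that \<epsilon> by (intro mix_contraction doubly_stochastic_window ds) auto
    moreover have "(1 - \<epsilon>) * d \<le> \<rho> ^ B * d"
      using bern spread_le_nonneg[OF that] by (rule mult_right_mono)
    ultimately show ?thesis by (meson order_trans spread_le_def)
  qed
  have blocks: "spread_le (mix (window A s (q * B)) x) (\<rho> ^ (q * B) * d)"
    if "spread_le x d" for s q d and x :: "'m \<Rightarrow> 'a"
  proof (induction q)
    case 0
    then show ?case using that by (simp add: mix_mat1)
  next
    case (Suc q)
    show ?case
      using block[OF Suc, of "s + q * B"]
      by (simp add: mix_mult[symmetric] window_add[symmetric] power_add add.commute mult.assoc)
  qed
  have "spread_le (mix (window A s k) x) ((1 / \<rho> ^ B) * \<rho> ^ k * d)"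
    if "spread_le x d" for s k d and x :: "'m \<Rightarrow> 'a"
  proof -
    let ?q = "k div B" and ?r = "k mod B"
    have "spread_le (mix (window A (s + ?q * B) ?r) (mix (window A s (?q * B)) x)) (\<rho> ^ (?q * B) * d)"
      by (intro mix_nonexpansive doubly_stochastic_window ds blocks that)
    then have "spread_le (mix (window A s k) x) (\<rho> ^ (?q * B) * d)"
      by (simp add: mix_mult[symmetric] window_add[symmetric])
    moreover have "\<rho> ^ (?q * B) * d \<le> (1 / \<rho> ^ B) * \<rho> ^ k * d"
    proof (rule mult_right_mono)
      have "k \<le> ?q * B + B"
        using B by (metis add_le_cancel_left div_mult_mod_eq mod_less_divisor less_imp_le_nat
            less_le_trans zero_less_one)
      have "\<rho> ^ (?q * B) * \<rho> ^ B \<le> \<rho> ^ k"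
        using \<rho> \<open>k \<le> ?q * B + B\<close> by (simp add: power_add[symmetric] power_decreasing)
      then show "\<rho> ^ (?q * B) \<le> (1 / \<rho> ^ B) * \<rho> ^ k"
        using \<rho> by (simp add: field_simps)
    qed (rule spread_le_nonneg[OF that])
    ultimately show ?thesis by (meson order_trans spread_le_def)
  qed
  moreover have "1 \<le> 1 / \<rho> ^ B" using \<rho> by (simp add: power_le_one)
  ultimately show thesis using that \<rho> by blast
qed

section \<open>Tangents of convex functions and the proximal operator\<close>

text \<open>
  The definite description in \<open>gradient\<close> is justified here by the Riesz representation of the derivative
  in the orthonormal basis.
\<close>

lemma gradient_has_derivative:
  assumes "g differentiable (at x)"
  shows "(g has_derivative (\<lambda>h. gradient g x \<bullet> h)) (at x)"
proof -
  obtain g' where g': "(g has_derivative g') (at x)"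
    using assms by (auto simp: differentiable_def)
  then have lin: "linear g'" by (rule has_derivative_linear)
  define D where "D = (\<Sum>b\<in>Basis. g' b *\<^sub>R b)"
  have "g' h = h \<bullet> D" for h
  proof -
    have "g' h = g' (\<Sum>b\<in>Basis. (h \<bullet> b) *\<^sub>R b)" by (simp add: euclidean_representation)
    also have "\<dots> = (\<Sum>b\<in>Basis. (h \<bullet> b) * g' b)"
      by (simp add: linear_sum[OF lin] linear_cmul[OF lin])
    also have "\<dots> = h \<bullet> D" by (simp add: D_def inner_sum_right mult.commute)
    finally show ?thesis .
  qed
  then have D: "GDERIV g x :> D" using g' unfolding gderiv_def by presburger
  moreover have "D' = D" if "GDERIV g x :> D'" for D'
  proof -
    have "(\<lambda>h. h \<bullet> D') = (\<lambda>h. h \<bullet> D)"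
      using that D unfolding gderiv_def by (rule has_derivative_unique)
    then have "(D' - D) \<bullet> D' = (D' - D) \<bullet> D" by meson
    then have "(D' - D) \<bullet> (D' - D) = 0" by (simp add: inner_diff_right)
    then show ?thesis by simp
  qed
  ultimately have "gradient g x = D" unfolding gradient_def by blast
  with D show ?thesis by (simp add: gderiv_def inner_commute)
qed

lemma convex_above_tangent:
  fixes g :: "'a::euclidean_space \<Rightarrow> real"
  assumes conv: "convex_on UNIV g" and der: "(g has_derivative (\<lambda>h. D \<bullet> h)) (at x)"
  shows "g x + D \<bullet> (y - x) \<le> g y"
proof -
  let ?l = "\<lambda>t::real. x + t *\<^sub>R (y - x)"
  have "convex_on UNIV (\<lambda>t. g (?l t))"
  proof (rule convex_onI)
    fix t a b :: real
    assume t: "0 < t" "t < 1"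
    have "?l ((1 - t) *\<^sub>R a + t *\<^sub>R b) = (1 - t) *\<^sub>R ?l a + t *\<^sub>R ?l b"
      by (simp add: algebra_simps)
    then show "g (?l ((1 - t) *\<^sub>R a + t *\<^sub>R b)) \<le> (1 - t) * g (?l a) + t * g (?l b)"
      using convex_onD[OF conv, of t "?l a" "?l b"] t by simp
  qed simp
  moreover have "((\<lambda>t. g (?l t)) has_field_derivative D \<bullet> (y - x)) (at 0)"
  proof -
    have "(?l has_derivative (\<lambda>t. t *\<^sub>R (y - x))) (at 0)"
      by (auto intro!: derivative_eq_intros)
    from has_derivative_compose[OF this, of g "\<lambda>h. D \<bullet> h"] der
    show ?thesis by (simp add: has_field_derivative_def mult.commute[of _ "D \<bullet> (y - x)"] mult_commute_abs)
  qed
  ultimately have "D \<bullet> (y - x) * (1 - 0) \<le> g (?l 1) - g (?l 0)"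
    by (intro convex_on_imp_above_tangent[where A = UNIV]) auto
  then show ?thesis by simp
qed

text \<open>
  The minimizer exists because the quadratic beats \<open>\<phi>\<close> far from \<open>v\<close>: along a ray from \<open>v\<close>, a convex
  function decreases at most linearly, with slope bounded by its decrease \<open>K\<close> on the unit ball.
\<close>

lemma prox_is_arg_min:
  fixes \<phi> :: "'a::euclidean_space \<Rightarrow> real"
  assumes conv: "convex_on UNIV \<phi>" and \<gamma>: "0 < \<gamma>"
  shows "\<phi> (prox \<gamma> \<phi> v) + 1 / (2 * \<gamma>) * (norm (prox \<gamma> \<phi> v - v))\<^sup>2
       \<le> \<phi> z + 1 / (2 * \<gamma>) * (norm (z - v))\<^sup>2"
proof -
  define h where "h z = \<phi> z + 1 / (2 * \<gamma>) * (norm (z - v))\<^sup>2" for z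
  have cont: "continuous_on S \<phi>" for S
    using convex_on_continuous[OF open_UNIV conv] continuous_on_subset by blast
  obtain w where w: "w \<in> cball v 1" "\<And>y. y \<in> cball v 1 \<Longrightarrow> \<phi> w \<le> \<phi> y"
    using continuous_attains_inf[OF compact_cball _ cont, of v 1] by auto
  define K where "K = \<phi> v - \<phi> w"
  have K0: "K \<ge> 0" using w(2)[of v] by (simp add: K_def)
  define r where "r = 2 * \<gamma> * K + 1"
  have r1: "r \<ge> 1" using K0 \<gamma> by (simp add: r_def)
  have far: "h v \<le> h y" if y: "y \<notin> cball v r" for y
  proof -
    let ?n = "norm (y - v)"
    have n: "?n > r" using y by (simp add: dist_norm norm_minus_commute)
    then have n1: "?n > 1" using r1 by simp
    let ?u = "(1 - 1 / ?n) *\<^sub>R v + (1 / ?n) *\<^sub>R y"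
    have "?u - v = (1 / ?n) *\<^sub>R (y - v)" by (simp add: algebra_simps)
    moreover have "y \<noteq> v" using n1 by auto
    ultimately have "norm (?u - v) = 1" by simp
    then have "?u \<in> cball v 1" by (simp add: dist_norm norm_minus_commute)
    then have "\<phi> w \<le> \<phi> ?u" by (rule w(2))
    also have "\<dots> \<le> (1 - 1 / ?n) * \<phi> v + (1 / ?n) * \<phi> y"
      using n1 by (intro convex_onD[OF conv]) (auto simp: divide_le_eq)
    finally have "\<phi> w * ?n \<le> ((1 - 1 / ?n) * \<phi> v + (1 / ?n) * \<phi> y) * ?n"
      using n1 by (intro mult_right_mono) auto
    also have "\<dots> = (?n - 1) * \<phi> v + \<phi> y"
      using n1 by (simp add: field_simps del: right_minus_eq eq_iff_diff_eq_0)
    finally have "\<phi> v - \<phi> y \<le> K * ?n" by (simp add: K_def algebra_simps)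
    also have "\<dots> \<le> 1 / (2 * \<gamma>) * ?n * ?n"
    proof (rule mult_right_mono)
      have "2 * \<gamma> * K \<le> ?n" using n by (simp add: r_def)
      then show "K \<le> 1 / (2 * \<gamma>) * ?n" using \<gamma> by (simp add: field_simps)
    qed simp
    finally show ?thesis by (simp add: h_def power2_eq_square)
  qed
  have "continuous_on (cball v r) h"
    unfolding h_def by (intro continuous_intros cont)
  then obtain q where q: "q \<in> cball v r" "\<And>y. y \<in> cball v r \<Longrightarrow> h q \<le> h y"
    using continuous_attains_inf[OF compact_cball, of v r h] r1 by auto
  have "h q \<le> h y" for y
  proof (cases "y \<in> cball v r")
    case False
    have "h q \<le> h v" using r1 by (intro q(2)) simp
    with far[OF False] show ?thesis by simp
  qed (rule q(2))
  then have "is_arg_min h (\<lambda>_. True) q" by (auto simp: is_arg_min_def not_less)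
  then have "is_arg_min h (\<lambda>_. True) (arg_min h (\<lambda>_. True))"
    unfolding arg_min_def by (rule someI)
  moreover have "prox \<gamma> \<phi> v = arg_min h (\<lambda>_. True)"
    by (simp add: prox_def h_def[abs_def])
  ultimately have "h (prox \<gamma> \<phi> v) \<le> h z"
    by (simp add: is_arg_min_def not_less)
  then show ?thesis by (simp add: h_def)
qed

text \<open>
  The optimality condition of the proximal problem, obtained by comparing the minimizer \<open>p\<close> with the
  points \<open>(1 - \<theta>) p + \<theta> y\<close> and letting \<open>\<theta>\<close> tend to zero, when the quadratic term in \<open>\<theta>\<close> disappears.
\<close>

lemma prox_subgradient:
  fixes \<phi> :: "'a::euclidean_space \<Rightarrow> real"
  assumes conv: "convex_on UNIV \<phi>" and \<gamma>: "0 < \<gamma>"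
  shows "(1 / \<gamma>) *\<^sub>R (v - prox \<gamma> \<phi> v) \<in> subdifferential \<phi> (prox \<gamma> \<phi> v)"
  unfolding subdifferential_def
proof (intro CollectI allI)
  fix y
  define p where "p = prox \<gamma> \<phi> v"
  define c where "c = 1 / \<gamma>"
  have approx: "c * ((v - p) \<bullet> (y - p)) \<le> (\<phi> y - \<phi> p) + \<theta> * (c / 2 * (norm (y - p))\<^sup>2)"
    if \<theta>: "0 < \<theta>" "\<theta> < 1" for \<theta>
  proof -
    define z where "z = (1 - \<theta>) *\<^sub>R p + \<theta> *\<^sub>R y"
    have z: "z - v = (p - v) + \<theta> *\<^sub>R (y - p)" by (simp add: z_def algebra_simps)
    have N: "(norm (z - v))\<^sup>2 = (norm (p - v))\<^sup>2 + 2 * \<theta> * ((p - v) \<bullet> (y - p)) + \<theta>\<^sup>2 * (norm (y - p))\<^sup>2"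
      unfolding z power2_norm_eq_inner
      by (simp add: inner_add_left inner_add_right inner_commute power2_eq_square)
    have "c / 2 * (norm (z - v))\<^sup>2
        = c / 2 * (norm (p - v))\<^sup>2 + \<theta> * (c * ((p - v) \<bullet> (y - p))) + \<theta> * (\<theta> * (c / 2 * (norm (y - p))\<^sup>2))"
      unfolding N by (simp add: field_simps power2_eq_square)
    moreover have "\<phi> p + c / 2 * (norm (p - v))\<^sup>2 \<le> \<phi> z + c / 2 * (norm (z - v))\<^sup>2"
      using prox_is_arg_min[OF conv \<gamma>, of v z] by (simp add: p_def c_def)
    moreover have "\<phi> z \<le> (1 - \<theta>) * \<phi> p + \<theta> * \<phi> y"
      unfolding z_def using \<theta> by (intro convex_onD[OF conv]) auto
    ultimately have "0 \<le> \<theta> * ((\<phi> y - \<phi> p) + c * ((p - v) \<bullet> (y - p)) + \<theta> * (c / 2 * (norm (y - p))\<^sup>2))"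
      unfolding distrib_left left_diff_distrib right_diff_distrib by linarith
    then have "0 \<le> (\<phi> y - \<phi> p) + c * ((p - v) \<bullet> (y - p)) + \<theta> * (c / 2 * (norm (y - p))\<^sup>2)"
      using \<theta> by (simp add: zero_le_mult_iff)
    then show ?thesis by (simp add: inner_diff_left algebra_simps)
  qed
  have "c * ((v - p) \<bullet> (y - p)) \<le> (\<phi> y - \<phi> p) + 0 * (c / 2 * (norm (y - p))\<^sup>2)"
  proof (rule tendsto_le[OF _ _ tendsto_const])
    show "((\<lambda>\<theta>. (\<phi> y - \<phi> p) + \<theta> * (c / 2 * (norm (y - p))\<^sup>2))
        \<longlongrightarrow> (\<phi> y - \<phi> p) + 0 * (c / 2 * (norm (y - p))\<^sup>2)) (at_right 0)"
      by (intro tendsto_intros)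
    show "\<forall>\<^sub>F \<theta> in at_right 0. c * ((v - p) \<bullet> (y - p)) \<le> (\<phi> y - \<phi> p) + \<theta> * (c / 2 * (norm (y - p))\<^sup>2)"
      unfolding eventually_at_right_field using approx by (intro exI[of _ 1]) auto
  qed simp
  then show "\<phi> (prox \<gamma> \<phi> v) + (1 / \<gamma>) *\<^sub>R (v - prox \<gamma> \<phi> v) \<bullet> (y - prox \<gamma> \<phi> v) \<le> \<phi> y"
    by (simp add: p_def c_def)
qed

text \<open>
  Monotonicity of the subdifferential: adding the subgradient inequalities at the two proximal points
  gives \<open>norm (p - q) ^ 2 \<le> (v - w) \<bullet> (p - q)\<close>.
\<close>

lemma prox_nonexpansive:
  fixes \<phi> :: "'a::euclidean_space \<Rightarrow> real"
  assumes conv: "convex_on UNIV \<phi>" and \<gamma>: "0 < \<gamma>"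
  shows "norm (prox \<gamma> \<phi> v - prox \<gamma> \<phi> w) \<le> norm (v - w)"
proof -
  define p q where "p = prox \<gamma> \<phi> v" and "q = prox \<gamma> \<phi> w"
  have "\<phi> p + (1 / \<gamma>) *\<^sub>R (v - p) \<bullet> (q - p) \<le> \<phi> q" "\<phi> q + (1 / \<gamma>) *\<^sub>R (w - q) \<bullet> (p - q) \<le> \<phi> p"
    using prox_subgradient[OF conv \<gamma>, of v] prox_subgradient[OF conv \<gamma>, of w]
    by (auto simp: subdifferential_def p_def q_def)
  then have "(1 / \<gamma>) * ((v - p) \<bullet> (q - p) + (w - q) \<bullet> (p - q)) \<le> 0"
    by (simp add: distrib_left)
  then have "(v - p) \<bullet> (q - p) + (w - q) \<bullet> (p - q) \<le> 0"
    using \<gamma> by (simp add: field_simps)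
  then have "(p - q) \<bullet> (p - q) \<le> (v - w) \<bullet> (p - q)"
    by (simp add: inner_diff_left inner_diff_right)
  also have "\<dots> \<le> norm (v - w) * norm (p - q)" by (rule norm_cauchy_schwarz)
  finally have "norm (p - q) * norm (p - q) \<le> norm (v - w) * norm (p - q)"
    by (simp add: power2_norm_eq_inner[symmetric] power2_eq_square)
  then show ?thesis
    unfolding p_def q_def by (metis mult_right_le_imp_le norm_ge_zero not_le order_trans)
qed

section \<open>One local pass over the samples\<close>

lemma local_pass_near:
  assumes "\<And>i. i < k \<Longrightarrow> norm (gradient (g (p ! i)) (local_pass \<gamma> g p i x)) \<le> G" "0 \<le> \<gamma>"
  shows "norm (local_pass \<gamma> g p k x - x) \<le> \<gamma> * (real k * G)"
  using assms(1)
proof (induction k)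
  case (Suc k)
  have "norm (local_pass \<gamma> g p (Suc k) x - x)
      = norm ((local_pass \<gamma> g p k x - x) - \<gamma> *\<^sub>R gradient (g (p ! k)) (local_pass \<gamma> g p k x))"
    by (simp add: algebra_simps)
  also have "\<dots> \<le> norm (local_pass \<gamma> g p k x - x) + norm (\<gamma> *\<^sub>R gradient (g (p ! k)) (local_pass \<gamma> g p k x))"
    by (rule norm_triangle_ineq4)
  also have "\<dots> \<le> \<gamma> * (real k * G) + \<gamma> * G"
    using Suc assms(2) by (intro add_mono Suc.IH) (auto intro!: mult_left_mono)
  finally show ?case by (simp add: algebra_simps)
qed simp

definition pass_direction ::
  "real \<Rightarrow> (nat \<Rightarrow> 'a::euclidean_space \<Rightarrow> real) \<Rightarrow> nat list \<Rightarrow> nat \<Rightarrow> 'a \<Rightarrow> 'a" where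
  "pass_direction \<gamma> g p k x = (\<Sum>i<k. gradient (g (p ! i)) (local_pass \<gamma> g p i x))"

lemma local_pass_eq: "local_pass \<gamma> g p k x = x - \<gamma> *\<^sub>R pass_direction \<gamma> g p k x"
  by (induction k) (auto simp: pass_direction_def algebra_simps)

lemma norm_pass_direction_le:
  assumes p: "p \<in> permutations_of_set {1..n}"
    and G: "\<And>i x. i \<in> {1..n} \<Longrightarrow> norm (gradient (g i) x) \<le> G"
  shows "norm (pass_direction \<gamma> g p n x) \<le> real n * G"
proof -
  have "p ! i \<in> {1..n}" if "i < n" for i
    using p that permutations_of_setD[OF p] length_finite_permutations_of_set[OF p]
    by (metis card_atLeastAtMost diff_Suc_1 nth_mem)
  then show ?thesis
    unfolding pass_direction_def
    using sum_norm_le[of "{..<n}" "\<lambda>i. gradient (g (p ! i)) (local_pass \<gamma> g p i x)" "\<lambda>_. G"] G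
    by simp
qed

text \<open>
  The order of the samples is forgotten at the price of an error of size \<open>\<gamma>\<close>: the gradients are
  evaluated within distance \<open>\<gamma> * (real n * G)\<close> of \<open>x\<close>, and at \<open>x\<close> itself their sum does not depend on
  the permutation.
\<close>

lemma pass_direction_error:
  assumes p: "p \<in> permutations_of_set {1..n}" and \<gamma>: "0 \<le> \<gamma>" and "0 \<le> G" and L: "0 \<le> L"
    and G: "\<And>i x. i \<in> {1..n} \<Longrightarrow> norm (gradient (g i) x) \<le> G"
    and lip: "\<And>i x y. i \<in> {1..n} \<Longrightarrow> norm (gradient (g i) x - gradient (g i) y) \<le> L * norm (x - y)"
  shows "norm (pass_direction \<gamma> g p n x - (\<Sum>i=1..n. gradient (g i) x)) \<le> real n * (L * (\<gamma> * (real n * G)))"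
proof -
  have len: "length p = n" and sp: "set p = {1..n}" "distinct p"
    using permutations_of_setD[OF p] length_finite_permutations_of_set[OF p] by auto
  have pi: "p ! i \<in> {1..n}" if "i < n" for i
    using that len sp by (metis nth_mem)
  have "bij_betw ((!) p) {..<n} {1..n}"
    using sp len by (intro bij_betw_nth) auto
  then have "(\<Sum>i=1..n. gradient (g i) x) = (\<Sum>i<n. gradient (g (p ! i)) x)"
    by (simp add: sum.reindex_bij_betw[symmetric])
  then have "pass_direction \<gamma> g p n x - (\<Sum>i=1..n. gradient (g i) x)
      = (\<Sum>i<n. gradient (g (p ! i)) (local_pass \<gamma> g p i x) - gradient (g (p ! i)) x)"
    by (simp add: pass_direction_def sum_subtractf)
  also have "norm \<dots> \<le> (\<Sum>i<n. L * (\<gamma> * (real n * G)))"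
  proof (rule sum_norm_le)
    fix i assume "i \<in> {..<n}"
    then have i: "i < n" by simp
    have "norm (local_pass \<gamma> g p i x - x) \<le> \<gamma> * (real i * G)"
      using i \<gamma> by (intro local_pass_near G pi) auto
    also have "\<dots> \<le> \<gamma> * (real n * G)"
      using i \<gamma> \<open>0 \<le> G\<close> by (intro mult_left_mono mult_right_mono) auto
    finally show "norm (gradient (g (p ! i)) (local_pass \<gamma> g p i x) - gradient (g (p ! i)) x)
        \<le> L * (\<gamma> * (real n * G))"
      using lip[OF pi[OF i]] L by (meson mult_left_mono order_trans)
  qed
  finally show ?thesis by simp
qed

section \<open>A discrete Gronwall inequality\<close>

text \<open>
  The gains \<open>h\<close> are kept: adding \<open>1\<close> to \<open>S\<close> absorbs the additive error,
  so that \<open>1 + S t\<close> plus the gains collected so far grows at most by the factor \<open>1 + e t \<le> exp (e t)\<close>.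
  This takes the place of an a priori bound on \<open>S\<close>.
\<close>

lemma sum_le_exp_sum:
  fixes S e h :: "nat \<Rightarrow> real"
  assumes "\<And>t. 0 \<le> S t" "\<And>t. 0 \<le> h t" "\<And>t. 0 \<le> e t"
    and step: "\<And>t. S (Suc t) + h t \<le> (1 + e t) * S t + e t"
  shows "(\<Sum>t<T. h t) \<le> (1 + S 0) * exp (\<Sum>t<T. e t)"
proof -
  have "1 + S T + (\<Sum>t<T. h t) \<le> (1 + S 0) * exp (\<Sum>t<T. e t)"
  proof (induction T)
    case (Suc T)
    have h: "0 \<le> (\<Sum>t<T. h t)" by (intro sum_nonneg assms)
    have "1 + S (Suc T) + (\<Sum>t<Suc T. h t) \<le> (1 + e T) * (1 + S T) + (\<Sum>t<T. h t)"
      using step[of T] by (simp add: algebra_simps)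
    also have "\<dots> \<le> (1 + e T) * (1 + S T + (\<Sum>t<T. h t))"
      using h assms(3)[of T] by (simp add: algebra_simps)
    also have "\<dots> \<le> exp (e T) * ((1 + S 0) * exp (\<Sum>t<T. e t))"
      using Suc assms(1)[of T] assms(3)[of T] h by (intro mult_mono) auto
    finally show ?case by (simp add: exp_add algebra_simps)
  qed simp
  then show ?thesis using assms(1)[of T] by linarith
qed

section \<open>A run along a fixed sequence of permutations\<close>

locale dpg_run =
  fixes f :: "'m::finite \<Rightarrow> nat \<Rightarrow> 'a::euclidean_space \<Rightarrow> real"
    and n :: nat and \<phi> :: "'a \<Rightarrow> real" and L Gf G\<phi> \<gamma> :: real
    and A :: "nat \<Rightarrow> real^'m^'m" and x0 :: "'m \<Rightarrow> 'a" and p :: "nat \<Rightarrow> nat list"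
  assumes differentiable: "\<And>j i x. i \<in> {1..n} \<Longrightarrow> f j i differentiable (at x)"
    and convex_smooth: "convex_on UNIV (smooth_part f n)"
    and convex_phi: "convex_on UNIV \<phi>"
    and L_nonneg: "0 \<le> L"
    and lipschitz: "\<And>j i x y. i \<in> {1..n} \<Longrightarrow>
      norm (gradient (f j i) x - gradient (f j i) y) \<le> L * norm (x - y)"
    and Gf_nonneg: "0 \<le> Gf"
    and gradient_bound: "\<And>j i x. i \<in> {1..n} \<Longrightarrow> norm (gradient (f j i) x) \<le> Gf"
    and subgradient_bound: "\<And>x z. z \<in> subdifferential \<phi> x \<Longrightarrow> norm z \<le> G\<phi>"
    and weights: "\<And>s. doubly_stochastic (A s)"
    and step_pos: "0 < \<gamma>"
    and perm: "\<And>t. p t \<in> permutations_of_set {1..n}"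
begin

text \<open>
  Below, \<open>X t j\<close>, \<open>Y t j\<close> and \<open>V t j\<close> are the \<open>x\<^sub>j\<^sub>,\<^sub>t\<close>, \<open>x\<^sub>j\<^sub>,\<^sub>t\<^sup>n\<close> and \<open>v\<^sub>j\<^sub>,\<^sub>t\<close> of the algorithm. The vector \<open>z t j\<close> is the
  subgradient of \<open>\<phi>\<close> at \<open>x\<^sub>j\<^sub>,\<^sub>t\<^sub>+\<^sub>1\<close> selected by the proximal step, so that one iteration is, on average over
  the agents, a step of length \<open>\<gamma>\<close> against \<open>g\<close> and \<open>z\<close>, and \<open>G\<close> bounds the norm of that direction.
\<close>

definition X :: "nat \<Rightarrow> 'm \<Rightarrow> 'a" where "X = dpg_rr \<gamma> f n \<phi> A x0 p"

definition Y :: "nat \<Rightarrow> 'm \<Rightarrow> 'a" where "Y t j = local_pass \<gamma> (f j) (p t) n (X t j)"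

definition V :: "nat \<Rightarrow> 'm \<Rightarrow> 'a" where "V t = mix (window A (comm_steps t) (Suc t)) (Y t)"

definition g :: "nat \<Rightarrow> 'm \<Rightarrow> 'a" where "g t j = pass_direction \<gamma> (f j) (p t) n (X t j)"

definition z :: "nat \<Rightarrow> 'm \<Rightarrow> 'a" where "z t j = (1 / \<gamma>) *\<^sub>R (V t j - X (Suc t) j)"

definition mean_grad :: "'a \<Rightarrow> 'a" where "mean_grad x = agent_mean (\<lambda>j. \<Sum>i=1..n. gradient (f j i) x)"

definition G :: real where "G = real n * Gf + G\<phi>"

lemma X_0: "X 0 = x0"
  by (simp add: X_def)

lemma X_Suc: "X (Suc t) j = prox \<gamma> \<phi> (V t j)"
  by (simp add: X_def V_def Y_def mix_def transition_eq_window del: window.simps)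

lemma X_Suc_eq: "X (Suc t) j = V t j - \<gamma> *\<^sub>R z t j"
  using step_pos by (simp add: z_def)

lemma Y_eq: "Y t j = X t j - \<gamma> *\<^sub>R g t j"
  by (simp add: Y_def g_def local_pass_eq)

lemma z_subgradient: "z t j \<in> subdifferential \<phi> (X (Suc t) j)"
  unfolding z_def X_Suc by (rule prox_subgradient[OF convex_phi step_pos])

lemma norm_z_le: "norm (z t j) \<le> G\<phi>"
  using z_subgradient by (rule subgradient_bound)

lemma norm_g_le: "norm (g t j) \<le> real n * Gf"
  unfolding g_def by (intro norm_pass_direction_le perm gradient_bound)

lemma Gphi_nonneg: "0 \<le> G\<phi>"
  using norm_z_le[of undefined undefined] norm_ge_zero order_trans by blast

lemma G_nonneg: "0 \<le> G"
  using Gphi_nonneg Gf_nonneg by (simp add: G_def)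

lemma smooth_part_derivative: "(smooth_part f n has_derivative (\<lambda>h. mean_grad x \<bullet> h)) (at x)"
proof -
  have "((\<lambda>x. 1 / real CARD('m) * (\<Sum>j\<in>UNIV. \<Sum>i=1..n. f j i x)) has_derivative
      (\<lambda>h. 1 / real CARD('m) * (\<Sum>j\<in>UNIV. \<Sum>i=1..n. gradient (f j i) x \<bullet> h))) (at x)"
    by (intro has_derivative_mult_right has_derivative_sum gradient_has_derivative differentiable)
  moreover have "1 / real CARD('m) * (\<Sum>j\<in>UNIV. \<Sum>i=1..n. gradient (f j i) x \<bullet> h) = mean_grad x \<bullet> h" for h
    by (simp add: mean_grad_def agent_mean_def inner_sum_left)
  ultimately show ?thesis by (simp add: smooth_part_def[abs_def])
qed

lemma smooth_tangent: "smooth_part f n x + mean_grad x \<bullet> (y - x) \<le> smooth_part f n y"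
  by (rule convex_above_tangent[OF convex_smooth smooth_part_derivative])

lemma norm_mean_grad_le: "norm (mean_grad x) \<le> real n * Gf"
  unfolding mean_grad_def
  using sum_norm_le[of "{1..n}" "\<lambda>i. gradient (f _ i) x" "\<lambda>_. Gf"] gradient_bound
  by (intro norm_agent_mean_le) simp

lemma spread_Y:
  assumes "spread_le (X t) d"
  shows "spread_le (Y t) (d + 2 * (\<gamma> * (real n * Gf)))"
  unfolding spread_le_def
proof (intro allI)
  fix j k
  have g: "norm (\<gamma> *\<^sub>R g t j) \<le> \<gamma> * (real n * Gf)" for j
    using norm_g_le[of t j] step_pos by simp
  have "Y t j - Y t k = (X t j - X t k) - (\<gamma> *\<^sub>R g t j - \<gamma> *\<^sub>R g t k)"
    by (simp add: Y_eq)
  then have "norm (Y t j - Y t k) \<le> norm (X t j - X t k) + norm (\<gamma> *\<^sub>R g t j - \<gamma> *\<^sub>R g t k)"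
    by (simp only: norm_triangle_ineq4)
  also have "\<dots> \<le> d + (norm (\<gamma> *\<^sub>R g t j) + norm (\<gamma> *\<^sub>R g t k))"
    by (intro add_mono spread_leD[OF assms] norm_triangle_ineq4)
  also have "\<dots> \<le> d + (\<gamma> * (real n * Gf) + \<gamma> * (real n * Gf))"
    by (intro add_left_mono add_mono g)
  finally show "norm (Y t j - Y t k) \<le> d + 2 * (\<gamma> * (real n * Gf))"
    by (simp only: mult_2)
qed

lemma spread_X_Suc: "spread_le (V t) d \<Longrightarrow> spread_le (X (Suc t)) d"
  unfolding spread_le_def X_Suc
  using prox_nonexpansive[OF convex_phi step_pos] order_trans by blast

text \<open>
  Between two mixing phases the diameter grows by at most \<open>b\<close>. Ignoring the contraction, it grows
  linearly; since the phase of iteration \<open>t\<close> consists of \<open>t + 1\<close> communication steps, one application of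
  the mixing rate to this crude bound already gives a summable sequence. The bound depends on the
  step size through \<open>b\<close> alone.
\<close>

lemma consensus_rate:
  assumes rate: "\<And>s k d (x :: 'm \<Rightarrow> 'a).
      spread_le x d \<Longrightarrow> spread_le (mix (window A s k) x) (c * \<rho> ^ k * d)"
    and c: "1 \<le> c" and x0: "spread_le x0 R" and b: "2 * (\<gamma> * (real n * Gf)) \<le> b"
  shows "spread_le (X t) (c * \<rho> ^ t * (R + real t * b))"
proof -
  have Y: "spread_le (Y t) (R + real (Suc t) * b)" if "spread_le (X t) (R + real t * b)" for t
  proof -
    have "R + real t * b + 2 * (\<gamma> * (real n * Gf)) \<le> R + real (Suc t) * b"
      using b by (simp add: distrib_right)
    then show ?thesis using spread_Y[OF that] by (meson order_trans spread_le_def)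
  qed
  have slow: "spread_le (X t) (R + real t * b)" for t
  proof (induction t)
    case 0
    then show ?case using x0 by (simp add: X_0)
  next
    case (Suc t)
    show ?case
      by (intro spread_X_Suc) (unfold V_def, intro mix_nonexpansive doubly_stochastic_window weights Y Suc)
  qed
  show ?thesis
  proof (cases t)
    case 0
    have "R \<le> c * R" using c spread_le_nonneg[OF x0] by (simp add: mult_le_cancel_right1)
    then show ?thesis using x0 by (auto simp: 0 X_0 spread_le_def intro: order_trans)
  next
    case (Suc s)
    show ?thesis
      unfolding Suc by (intro spread_X_Suc) (unfold V_def, intro rate Y slow)
  qed
qed

lemma agent_mean_X_Suc:
  "agent_mean (X (Suc t)) = agent_mean (X t) - \<gamma> *\<^sub>R (agent_mean (g t) + agent_mean (z t))"
proof -
  have "agent_mean (V t) = agent_mean (Y t)"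
    unfolding V_def by (intro agent_mean_mix doubly_stochastic_window weights)
  moreover have "agent_mean (X (Suc t)) = agent_mean (V t) - \<gamma> *\<^sub>R agent_mean (z t)"
    using agent_mean_diff[of "V t" "\<lambda>j. \<gamma> *\<^sub>R z t j"]
    by (simp add: X_Suc_eq[symmetric] agent_mean_scaleR)
  moreover have "agent_mean (Y t) = agent_mean (X t) - \<gamma> *\<^sub>R agent_mean (g t)"
    using agent_mean_diff[of "X t" "\<lambda>j. \<gamma> *\<^sub>R g t j"]
    by (simp add: Y_eq[symmetric] agent_mean_scaleR)
  ultimately show ?thesis by (simp add: scaleR_add_right)
qed

lemma norm_mean_direction_le: "norm (agent_mean (g t) + agent_mean (z t)) \<le> G"
  unfolding G_def
  by (intro order_trans[OF norm_triangle_ineq] add_mono norm_agent_mean_le norm_g_le norm_z_le)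

lemma gradient_error:
  assumes "spread_le (X t) d"
  shows "norm (agent_mean (g t) - mean_grad (agent_mean (X t))) \<le> real n * L * (d + \<gamma> * (real n * Gf))"
proof -
  let ?xb = "agent_mean (X t)"
  have "norm (g t j - (\<Sum>i=1..n. gradient (f j i) ?xb)) \<le> real n * L * (d + \<gamma> * (real n * Gf))" for j
  proof -
    have 1: "norm (g t j - (\<Sum>i=1..n. gradient (f j i) (X t j))) \<le> real n * (L * (\<gamma> * (real n * Gf)))"
      unfolding g_def using step_pos
      by (intro pass_direction_error perm gradient_bound lipschitz Gf_nonneg L_nonneg) auto
    have near: "norm (X t j - ?xb) \<le> d"
      using spread_leD[OF assms] by (intro norm_diff_agent_mean)
    have "norm (\<Sum>i=1..n. gradient (f j i) (X t j) - gradient (f j i) ?xb) \<le> (\<Sum>i=1..n. L * d)"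
      by (intro sum_norm_le) (meson lipschitz near L_nonneg mult_left_mono order_trans)
    then have "norm ((\<Sum>i=1..n. gradient (f j i) (X t j)) - (\<Sum>i=1..n. gradient (f j i) ?xb))
        \<le> real n * (L * d)"
      by (simp add: sum_subtractf)
    from norm_diff_triangle_le[OF 1 this] show ?thesis by (simp add: algebra_simps)
  qed
  from norm_agent_mean_le[OF this] show ?thesis by (simp add: agent_mean_diff mean_grad_def)
qed

text \<open>
  Expand the squared distance of the average to the comparison point \<open>xs\<close>. The smooth part is linearised
  at the average, with an error from \<open>gradient_error\<close>; the non-smooth part is linearised at the points
  \<open>X (Suc t) j\<close>, where the subgradients \<open>z\<close> live. Both are then moved to \<open>X (Suc t) j\<close>, at distance at most
  \<open>d' + \<gamma> * G\<close> from the old average. The gradient error is multiplied by the distance to \<open>xs\<close>, for which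
  no bound is known in advance; \<open>2 * r \<le> 1 + r\<^sup>2\<close> turns this product into a relative growth of the
  squared distance.
\<close>

lemma descent:
  fixes xs :: 'a
  assumes d: "spread_le (X t) d" and d': "spread_le (X (Suc t)) d'"
  defines "e \<equiv> \<gamma> * (real n * L * (d + \<gamma> * (real n * Gf))) + 2 * \<gamma> * (G * d') + 3 * \<gamma>\<^sup>2 * G\<^sup>2"
  shows "(norm (agent_mean (X (Suc t)) - xs))\<^sup>2
      + 2 * \<gamma> * (agent_mean (\<lambda>j. objective f n \<phi> (X (Suc t) j)) - objective f n \<phi> xs)
      \<le> (1 + e) * (norm (agent_mean (X t) - xs))\<^sup>2 + e"
proof -
  let ?F = "objective f n \<phi>" and ?f = "smooth_part f n"
  define xb where "xb = agent_mean (X t)"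
  define w where "w = agent_mean (g t) + agent_mean (z t)"
  define err where "err = real n * L * (d + \<gamma> * (real n * Gf))"
  define r where "r = norm (xb - xs)"
  define \<delta> where "\<delta> = d' + \<gamma> * G"
  have d0: "0 \<le> d" "0 \<le> d'" using d d' by (auto dest: spread_le_nonneg)
  have err0: "0 \<le> err"
    using d0 L_nonneg step_pos Gf_nonneg by (simp add: err_def)
  have xb': "agent_mean (X (Suc t)) = xb - \<gamma> *\<^sub>R w"
    by (simp add: agent_mean_X_Suc xb_def w_def)
  have wG: "norm w \<le> G" unfolding w_def by (rule norm_mean_direction_le)
  have near: "norm (X (Suc t) j - xb) \<le> \<delta>" for j
  proof -
    have "norm (X (Suc t) j - agent_mean (X (Suc t))) \<le> d'"
      using spread_leD[OF d'] by (intro norm_diff_agent_mean)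
    moreover have "norm (\<gamma> *\<^sub>R w) \<le> \<gamma> * G" using wG step_pos by simp
    moreover have "norm (X (Suc t) j - xb) = norm ((X (Suc t) j - agent_mean (X (Suc t))) - \<gamma> *\<^sub>R w)"
      by (simp add: xb')
    ultimately show ?thesis
      using norm_triangle_ineq4[of "X (Suc t) j - agent_mean (X (Suc t))" "\<gamma> *\<^sub>R w"]
      unfolding \<delta>_def by linarith
  qed
  have smooth: "?f xb - ?f xs - err * r \<le> agent_mean (g t) \<bullet> (xb - xs)"
  proof -
    have "(mean_grad xb - agent_mean (g t)) \<bullet> (xb - xs) \<le> err * r"
      using norm_cauchy_schwarz[of "mean_grad xb - agent_mean (g t)" "xb - xs"]
        mult_right_mono[OF gradient_error[OF d] norm_ge_zero[of "xb - xs"]]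
      unfolding r_def err_def xb_def norm_minus_commute[of "agent_mean (g t)"] by linarith
    moreover have "?f xb - ?f xs \<le> mean_grad xb \<bullet> (xb - xs)"
      using smooth_tangent[of xb xs] by (simp add: inner_diff_right)
    ultimately show ?thesis by (simp add: inner_diff_left)
  qed
  have agent: "?F (X (Suc t) j) - ?F xs - G * \<delta> \<le> (?f xb - ?f xs) + z t j \<bullet> (xb - xs)" for j
  proof -
    let ?x = "X (Suc t) j"
    have "\<phi> ?x + z t j \<bullet> (xs - ?x) \<le> \<phi> xs"
      using z_subgradient[of t j] by (simp add: subdifferential_def)
    moreover have "z t j \<bullet> (?x - xb) \<le> G\<phi> * \<delta>"
      by (intro order_trans[OF norm_cauchy_schwarz] mult_mono norm_z_le near Gphi_nonneg) simp
    moreover have "?f ?x + mean_grad ?x \<bullet> (xb - ?x) \<le> ?f xb" by (rule smooth_tangent)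
    moreover have "mean_grad ?x \<bullet> (?x - xb) \<le> real n * Gf * \<delta>"
      by (intro order_trans[OF norm_cauchy_schwarz] mult_mono norm_mean_grad_le near) (auto simp: Gf_nonneg)
    ultimately show ?thesis
      by (simp add: objective_def G_def inner_diff_right distrib_right)
  qed
  have "agent_mean (\<lambda>j. ?F (X (Suc t) j)) - ?F xs - G * \<delta>
      = agent_mean (\<lambda>j. ?F (X (Suc t) j) - ?F xs - G * \<delta>)"
    by (simp add: agent_mean_diff agent_mean_const)
  also have "\<dots> \<le> agent_mean (\<lambda>j. (?f xb - ?f xs) + z t j \<bullet> (xb - xs))"
    by (intro agent_mean_mono agent)
  also have "\<dots> = (?f xb - ?f xs) + agent_mean (z t) \<bullet> (xb - xs)"
    by (simp add: agent_mean_add agent_mean_const agent_mean_inner)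
  finally have main: "agent_mean (\<lambda>j. ?F (X (Suc t) j)) - ?F xs - G * \<delta> - err * r \<le> w \<bullet> (xb - xs)"
    using smooth by (simp add: w_def inner_add_left)
  have "(norm (agent_mean (X (Suc t)) - xs))\<^sup>2 = r\<^sup>2 - 2 * \<gamma> * (w \<bullet> (xb - xs)) + \<gamma>\<^sup>2 * (norm w)\<^sup>2"
  proof -
    have "(norm (u - \<gamma> *\<^sub>R w))\<^sup>2 = (norm u)\<^sup>2 - 2 * \<gamma> * (w \<bullet> u) + \<gamma>\<^sup>2 * (norm w)\<^sup>2" for u
      unfolding power2_norm_eq_inner
      by (simp add: inner_diff_left inner_diff_right inner_commute power2_eq_square)
    moreover have eq: "agent_mean (X (Suc t)) - xs = (xb - xs) - \<gamma> *\<^sub>R w"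
      by (simp add: xb')
    ultimately show ?thesis unfolding r_def eq by blast
  qed
  moreover have "\<gamma>\<^sup>2 * (norm w)\<^sup>2 \<le> \<gamma>\<^sup>2 * G\<^sup>2"
    using wG by (intro mult_left_mono power_mono) auto
  moreover have "2 * \<gamma> * (agent_mean (\<lambda>j. ?F (X (Suc t) j)) - ?F xs - G * \<delta> - err * r)
      \<le> 2 * \<gamma> * (w \<bullet> (xb - xs))"
    using main step_pos by simp
  moreover have "\<gamma> * (err * (2 * r)) \<le> \<gamma> * (err * (1 + r\<^sup>2))"
    using step_pos err0 sum_squares_bound[of 1 r] by (intro mult_left_mono) (auto simp: power2_eq_square)
  moreover have "\<gamma> * err * r\<^sup>2 \<le> e * r\<^sup>2"
    unfolding e_def err_def
    using step_pos d0 G_nonneg by (intro mult_right_mono) auto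
  moreover have "e = \<gamma> * err + 2 * \<gamma> * (G * \<delta>) + \<gamma>\<^sup>2 * G\<^sup>2"
    by (simp add: e_def err_def \<delta>_def power2_eq_square algebra_simps)
  ultimately show ?thesis
    unfolding r_def[symmetric] xb_def[symmetric] by (simp add: algebra_simps)
qed

lemma convex_objective: "convex_on UNIV (objective f n \<phi>)"
  unfolding objective_def[abs_def] by (intro convex_on_add convex_smooth convex_phi)

lemma objective_ergodic_mean_le:
  assumes "T \<ge> 1"
  shows "real T * objective f n \<phi> (ergodic_mean X T)
      \<le> (\<Sum>t<T. agent_mean (\<lambda>j. objective f n \<phi> (X (Suc t) j)))"
proof -
  let ?F = "objective f n \<phi>"
  have "ergodic_mean X T = (\<Sum>t<T. (1 / real T) *\<^sub>R agent_mean (X (Suc t)))"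
    by (simp add: ergodic_mean_def agent_mean_def sum.atLeast1_atMost_eq scaleR_sum_right[symmetric])
  also have "?F \<dots> \<le> (\<Sum>t<T. 1 / real T * ?F (agent_mean (X (Suc t))))"
    using assms by (intro convex_on_sum[OF _ _ convex_objective]) (auto simp: lessThan_empty_iff)
  finally have "real T * ?F (ergodic_mean X T) \<le> real T * (\<Sum>t<T. 1 / real T * ?F (agent_mean (X (Suc t))))"
    by (rule mult_left_mono) simp
  also have "\<dots> = (\<Sum>t<T. ?F (agent_mean (X (Suc t))))"
    using assms by (simp add: sum_distrib_left)
  also have "\<dots> \<le> (\<Sum>t<T. agent_mean (\<lambda>j. ?F (X (Suc t) j)))"
    by (intro sum_mono convex_agent_mean convex_objective)
  finally show ?thesis .
qed

text \<open>
  Along \<open>T\<close> iterations the errors add up to at most \<open>W\<close>, independently of \<open>T\<close>: the terms of order \<open>\<gamma>\<^sup>2\<close>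
  because \<open>T * \<gamma>\<^sup>2 = M\<^sup>2\<close>, and those of order \<open>\<gamma> * d t\<close> because the diameters are summable. The gains are
  nonnegative as \<open>xs\<close> is a minimizer, and \<open>T * \<gamma> = M * sqrt T\<close> yields the rate.
\<close>

lemma ergodic_gap:
  fixes xs :: 'a
  assumes d: "\<And>t. spread_le (X t) (d t)"
    and K: "(\<Sum>t<T. d t) \<le> K" "(\<Sum>t<T. d (Suc t)) \<le> K"
    and T: "T \<ge> 1" and M: "0 < M" and \<gamma>: "\<gamma> = M / sqrt (real T)"
    and min: "\<And>y. objective f n \<phi> xs \<le> objective f n \<phi> y"
  defines "W \<equiv> real n * L * (M * K + real n * Gf * M\<^sup>2) + 2 * G * (M * K) + 3 * G\<^sup>2 * M\<^sup>2"
  shows "objective f n \<phi> (ergodic_mean X T) - objective f n \<phi> xs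
      \<le> (1 + (norm (agent_mean x0 - xs))\<^sup>2) * exp W / (2 * M) * (1 / sqrt (real T))"
proof -
  let ?F = "objective f n \<phi>"
  define S where "S t = (norm (agent_mean (X t) - xs))\<^sup>2" for t
  define h where "h t = 2 * \<gamma> * (agent_mean (\<lambda>j. ?F (X (Suc t) j)) - ?F xs)" for t
  define e where "e t = \<gamma> * (real n * L * (d t + \<gamma> * (real n * Gf))) + 2 * \<gamma> * (G * d (Suc t)) + 3 * \<gamma>\<^sup>2 * G\<^sup>2" for t
  have d0: "0 \<le> d t" for t using d by (rule spread_le_nonneg)
  have K0: "0 \<le> K" using K(1) d0 by (meson order_trans sum_nonneg)
  have sT: "sqrt (real T) \<ge> 1" using T by simp
  have \<gamma>M: "\<gamma> \<le> M" using M sT by (simp add: \<gamma> divide_le_eq)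
  have \<gamma>T2: "real T * \<gamma>\<^sup>2 = M\<^sup>2" using T by (simp add: \<gamma> power_divide)
  have \<gamma>T: "real T * \<gamma> = M * sqrt (real T)"
    using T by (simp add: \<gamma> field_simps)
  have S0: "0 \<le> S t" for t by (simp add: S_def)
  have h0: "0 \<le> h t" for t
  proof -
    have "?F xs \<le> agent_mean (\<lambda>j. ?F (X (Suc t) j))"
      using agent_mean_mono[of "\<lambda>_. ?F xs" "\<lambda>j. ?F (X (Suc t) j)"] min by (simp add: agent_mean_const)
    then show ?thesis using step_pos by (simp add: h_def)
  qed
  have e0: "0 \<le> e t" for t
    using d0 L_nonneg step_pos Gf_nonneg G_nonneg by (simp add: e_def)
  have "S (Suc t) + h t \<le> (1 + e t) * S t + e t" for t
    unfolding S_def h_def e_def by (intro descent d)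
  then have "(\<Sum>t<T. h t) \<le> (1 + S 0) * exp (\<Sum>t<T. e t)"
    using S0 h0 e0 by (intro sum_le_exp_sum)
  also have "\<dots> \<le> (1 + S 0) * exp W"
  proof -
    have "(\<Sum>t<T. e t) = real n * L * (\<gamma> * (\<Sum>t<T. d t)) + real n * L * (real n * Gf) * (real T * \<gamma>\<^sup>2)
        + 2 * G * (\<gamma> * (\<Sum>t<T. d (Suc t))) + 3 * G\<^sup>2 * (real T * \<gamma>\<^sup>2)"
    proof -
      have e_eq: "e t = (real n * L * \<gamma>) * d t + real n * L * (real n * Gf) * \<gamma>\<^sup>2
          + (2 * G * \<gamma>) * d (Suc t) + 3 * G\<^sup>2 * \<gamma>\<^sup>2" for t
        by (simp add: e_def algebra_simps power2_eq_square)
      show ?thesis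
        unfolding e_eq sum.distrib sum_distrib_left[symmetric] by (simp add: algebra_simps)
    qed
    also have "\<dots> \<le> real n * L * (M * K) + real n * L * (real n * Gf) * M\<^sup>2
        + 2 * G * (M * K) + 3 * G\<^sup>2 * M\<^sup>2"
    proof -
      have "\<gamma> * (\<Sum>t<T. d t) \<le> M * K" "\<gamma> * (\<Sum>t<T. d (Suc t)) \<le> M * K"
        using M by (intro mult_mono \<gamma>M K sum_nonneg d0; simp)+
      then show ?thesis
        unfolding \<gamma>T2 using L_nonneg G_nonneg
        by (intro add_mono mult_left_mono order_refl) auto
    qed
    also have "\<dots> = W" by (simp add: W_def algebra_simps)
    finally show ?thesis using S0 by (intro mult_left_mono) (auto simp: add_nonneg_nonneg)
  qed
  finally have upper: "(\<Sum>t<T. h t) \<le> (1 + S 0) * exp W" .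
  have "(\<Sum>t<T. h t) = 2 * \<gamma> * ((\<Sum>t<T. agent_mean (\<lambda>j. ?F (X (Suc t) j))) - real T * ?F xs)"
    by (simp add: h_def sum_distrib_left[symmetric] sum_subtractf)
  moreover have "2 * \<gamma> * (real T * ?F (ergodic_mean X T) - real T * ?F xs)
      \<le> 2 * \<gamma> * ((\<Sum>t<T. agent_mean (\<lambda>j. ?F (X (Suc t) j))) - real T * ?F xs)"
    using objective_ergodic_mean_le[OF T] step_pos by (intro mult_left_mono) auto
  ultimately have "2 * (real T * \<gamma>) * (?F (ergodic_mean X T) - ?F xs) \<le> (1 + S 0) * exp W"
    using upper by (simp add: algebra_simps)
  then have "(?F (ergodic_mean X T) - ?F xs) * (2 * M * sqrt (real T)) \<le> (1 + S 0) * exp W"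
    unfolding \<gamma>T by (simp add: mult_ac)
  then have "?F (ergodic_mean X T) - ?F xs \<le> (1 + S 0) * exp W / (2 * M * sqrt (real T))"
    using M sT by (subst pos_le_divide_eq) auto
  then show ?thesis by (simp add: S_def X_0)
qed

end

section \<open>Consensus and convergence rate\<close>

text \<open>
  For a non-integrable function the expectation is by convention \<open>0\<close>, and then the bound \<open>c\<close> is
  nonnegative anyway.
\<close>

lemma integral_le_nonneg_bound:
  fixes F :: "'w \<Rightarrow> real"
  assumes "prob_space \<Omega>" "0 \<le> c" "\<And>\<omega>. \<omega> \<in> space \<Omega> \<Longrightarrow> F \<omega> \<le> c"
  shows "prob_space.expectation \<Omega> F \<le> c"
proof (cases "integrable \<Omega> F")
  case True
  interpret prob_space \<Omega> by fact
  show ?thesis using True assms(3) by (intro integral_le_const) auto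
next
  case False
  then show ?thesis using assms(2) by (simp add: not_integrable_integral_eq)
qed

lemma summable_geometric_linear:
  fixes \<rho> a b :: real
  assumes "0 < \<rho>" "\<rho> < 1"
  shows "summable (\<lambda>t. \<rho> ^ t * (a + real t * b))"
proof -
  have "summable (\<lambda>t. \<rho> ^ t)" using assms by simp
  moreover have "summable (\<lambda>t. real (Suc t) * \<rho> ^ t)"
    using geometric_deriv_sums[of \<rho>] assms by (auto simp: sums_iff)
  ultimately have "summable (\<lambda>t. (a - b) * \<rho> ^ t + b * (real (Suc t) * \<rho> ^ t))"
    by (intro summable_add summable_mult)
  then show ?thesis by (simp add: algebra_simps)
qed

theorem mainTheorem1:
  fixes f :: "'m::finite \<Rightarrow> nat \<Rightarrow> 'a::euclidean_space \<Rightarrow> real"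
    and \<phi> :: "'a \<Rightarrow> real"
    and n :: nat
    and L M :: real
    and E :: "nat \<Rightarrow> 'm set set"
    and A :: "nat \<Rightarrow> real^'m^'m"
    and x0 :: "'m \<Rightarrow> 'a"
    and xstar :: 'a
    and \<Omega> :: "'w measure"
    and \<pi> :: "nat \<Rightarrow> 'w \<Rightarrow> nat list"
  assumes "n \<ge> 1"
    and "problem_assms f n \<phi> L"
    and "is_arg_min (objective f n \<phi>) (\<lambda>_. True) xstar"
    and "network_assms E A"
    and "prob_space \<Omega>"
    and "iid_uniform_permutations \<Omega> n \<pi>"
    and "0 < M" and "M \<le> sqrt 6 / (6 * L * real n)"
  shows "(\<forall>T::nat. T \<ge> 1 \<longrightarrow> (\<forall>\<omega>\<in>space \<Omega>. \<forall>j.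
            (\<lambda>t. norm (dpg_rr (M / sqrt (real T)) f n \<phi> A x0 (\<lambda>s. \<pi> s \<omega>) t j
                  - agent_mean (dpg_rr (M / sqrt (real T)) f n \<phi> A x0 (\<lambda>s. \<pi> s \<omega>) t)))
            \<longlonglongrightarrow> 0))
       \<and> (\<exists>C. \<forall>T::nat. T \<ge> 1 \<longrightarrow>
            prob_space.expectation \<Omega>
              (\<lambda>\<omega>. objective f n \<phi>
                     (ergodic_mean (dpg_rr (M / sqrt (real T)) f n \<phi> A x0 (\<lambda>s. \<pi> s \<omega>)) T)
                   - objective f n \<phi> xstar)
            \<le> C * (1 / real T + 1 / sqrt (real T)))"
proof -
  let ?x = "\<lambda>T \<omega>. dpg_rr (M / sqrt (real T)) f n \<phi> A x0 (\<lambda>s. \<pi> s \<omega>)"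
  let ?F = "objective f n \<phi>"
  obtain G\<phi> where G\<phi>: "\<And>x z. z \<in> subdifferential \<phi> x \<Longrightarrow> norm z < G\<phi>"
    using assms(2) unfolding problem_assms_def by blast
  obtain Gf where Gf: "\<And>j i x. i \<in> {1..n} \<Longrightarrow> norm (gradient (f j i) x) < Gf"
    using assms(2) unfolding problem_assms_def by blast
  have "norm (gradient (f undefined 1) 0) < Gf" using \<open>n \<ge> 1\<close> by (intro Gf) simp
  then have Gf0: "0 \<le> Gf" by (meson norm_ge_zero le_less_trans less_imp_le)
  have L: "0 < L" using assms(2) by (simp add: problem_assms_def)
  have perm: "\<pi> t \<omega> \<in> permutations_of_set {1..n}" if "\<omega> \<in> space \<Omega>" for t \<omega>
  proof -
    interpret prob_space \<Omega> by fact
    have "\<pi> t \<in> measurable \<Omega> (count_space (permutations_of_set {1..n}))"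
      using assms(6) unfolding iid_uniform_permutations_def indep_vars_def by blast
    from measurable_space[OF this that] show ?thesis by simp
  qed
  have run: "dpg_run f n \<phi> L Gf G\<phi> (M / sqrt (real T)) A (\<lambda>s. \<pi> s \<omega>)"
    if "T \<ge> 1" "\<omega> \<in> space \<Omega>" for T \<omega>
    using assms(2,4,7) that perm L Gf0
    by unfold_locales
      (auto simp: problem_assms_def network_assms_def intro: less_imp_le[OF G\<phi>] less_imp_le[OF Gf])
  obtain c \<rho> where c: "1 \<le> c" and \<rho>: "0 < \<rho>" "\<rho> < 1"
    and rate: "\<And>s k d (x :: 'm \<Rightarrow> 'a). spread_le x d \<Longrightarrow> spread_le (mix (window A s k) x) (c * \<rho> ^ k * d)"
    using network_mixing_rate[OF assms(4)] by blast
  \<comment> \<open>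
    From here on \<open>R\<close>, \<open>b\<close>, \<open>d\<close> and the constants derived from them are chosen independently of \<open>T\<close>
    and of the permutations; \<open>b\<close> uses \<open>M / sqrt T \<le> M\<close>.
  \<close>
  define R where "R = Max (range (\<lambda>(j, k). norm (x0 j - x0 k)))"
  have R: "spread_le x0 R"
    unfolding spread_le_def R_def by (auto intro!: Max_ge)
  define b where "b = 2 * (M * (real n * Gf))"
  define d where "d t = c * \<rho> ^ t * (R + real t * b)" for t
  have d_summable: "summable d"
    using summable_mult[OF summable_geometric_linear[OF \<rho>, of R b], of c]
    by (simp add: d_def[abs_def] mult.assoc)
  have step_le: "M / sqrt (real T) \<le> M" if "T \<ge> 1" for T :: nat
    using that \<open>0 < M\<close> by (simp add: divide_le_eq)
  have spread: "spread_le (?x T \<omega> t) (d t)" if T: "T \<ge> 1" and \<omega>: "\<omega> \<in> space \<Omega>" for T \<omega> t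
  proof -
    interpret dpg_run f n \<phi> L Gf G\<phi> "M / sqrt (real T)" A x0 "\<lambda>s. \<pi> s \<omega>"
      by (rule run[OF T \<omega>])
    have "2 * (M / sqrt (real T) * (real n * Gf)) \<le> b"
      unfolding b_def using step_le[OF T] Gf0 by (intro mult_left_mono mult_right_mono) auto
    from consensus_rate[OF rate c R this] show ?thesis by (simp add: X_def d_def)
  qed
  have d0: "0 \<le> d t" for t
  proof -
    have "0 \<le> b" using \<open>0 < M\<close> Gf0 by (simp add: b_def)
    then show ?thesis using c \<rho> spread_le_nonneg[OF R] by (simp add: d_def)
  qed
  have consensus: "(\<lambda>t. norm (?x T \<omega> t j - agent_mean (?x T \<omega> t))) \<longlonglongrightarrow> 0"
    if "T \<ge> 1" "\<omega> \<in> space \<Omega>" for T \<omega> j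
  proof (rule tendsto_sandwich[OF _ _ tendsto_const summable_LIMSEQ_zero[OF d_summable]])
    show "\<forall>\<^sub>F t in sequentially. norm (?x T \<omega> t j - agent_mean (?x T \<omega> t)) \<le> d t"
      using spread_leD[OF spread[OF that]] by (intro always_eventually allI norm_diff_agent_mean)
  qed simp
  define K where "K = suminf d"
  define Gtot where "Gtot = real n * Gf + G\<phi>"
  define W where "W = real n * L * (M * K + real n * Gf * M\<^sup>2) + 2 * Gtot * (M * K) + 3 * Gtot\<^sup>2 * M\<^sup>2"
  define C where "C = (1 + (norm (agent_mean x0 - xstar))\<^sup>2) * exp W / (2 * M)"
  have C0: "0 \<le> C" using \<open>0 < M\<close> by (simp add: C_def)
  have gap: "?F (ergodic_mean (?x T \<omega>) T) - ?F xstar \<le> C * (1 / sqrt (real T))"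
    if T: "T \<ge> 1" and \<omega>: "\<omega> \<in> space \<Omega>" for T \<omega>
  proof -
    interpret dpg_run f n \<phi> L Gf G\<phi> "M / sqrt (real T)" A x0 "\<lambda>s. \<pi> s \<omega>"
      by (rule run[OF T \<omega>])
    have K1: "(\<Sum>t<T. d t) \<le> K"
      unfolding K_def using d0 by (intro sum_le_suminf d_summable) auto
    have "(\<Sum>t<Suc T. d t) \<le> K"
      unfolding K_def using d0 by (intro sum_le_suminf d_summable) auto
    then have K2: "(\<Sum>t<T. d (Suc t)) \<le> K"
      unfolding sum.lessThan_Suc_shift using d0[of 0] by linarith
    show ?thesis
      using ergodic_gap[OF _ K1 K2 T \<open>0 < M\<close> refl, of xstar] spread[OF T \<omega>] assms(3)
      by (simp add: X_def G_def Gtot_def W_def C_def is_arg_min_def not_less)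
  qed
  have "prob_space.expectation \<Omega> (\<lambda>\<omega>. ?F (ergodic_mean (?x T \<omega>) T) - ?F xstar)
      \<le> C * (1 / real T + 1 / sqrt (real T))" if T: "T \<ge> 1" for T
  proof (rule integral_le_nonneg_bound[OF \<open>prob_space \<Omega>\<close>])
    show "0 \<le> C * (1 / real T + 1 / sqrt (real T))" using C0 by simp
    show "?F (ergodic_mean (?x T \<omega>) T) - ?F xstar \<le> C * (1 / real T + 1 / sqrt (real T))"
      if "\<omega> \<in> space \<Omega>" for \<omega>
    proof -
      have "C * (1 / sqrt (real T)) \<le> C * (1 / real T + 1 / sqrt (real T))"
        using C0 by (intro mult_left_mono) auto
      with gap[OF T that] show ?thesis by linarith
    qed
  qed
  with consensus show ?thesis by blast
qed

end
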